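(* For $N\ge0$ let $|\mathcal{C}_j^X(N)|$ denote the number of $j$-core abaci of type $X$ of height $N$, i.e. $\#\{\mu\in W\Lambda_j:\ \mathrm{ht}(\Lambda_j-\mu)=N\}$. Then $$|\mathcal{C}_j^X(N)|=\begin{cases}\frac18 r_2(16N+10)=\frac12\sum_{d\mid 16N+10}\chi_4(d), & j\in\{0,2\},\ X=C_2^{(1)};\\ \frac18 r_2(12N+5)=\frac12\sum_{d\mid 12N+5}\chi_4(d), & j\in\{0,2\},\ X=D_2^{(2)};\\ \frac14 r_2(16N+2)=\sum_{d\mid 16N+2}\chi_4(d), & j=1,\ X=C_2^{(1)};\\ \frac14 r_2(6N+2)=\sum_{d\mid 6N+2}\chi_4(d), & j=1,\ X=D_2^{(2)}.\end{cases}$$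
   Context: The types are given by their Cartan matrices $(a_{ik})=(\langle\alpha_i^\vee,\alpha_k\rangle)$, $i,k\in\{0,1,2\}$. - $C_2^{(1)}$: rows $(2,-1,0),(-2,2,-2),(0,-1,2)$. - $D_2^{(2)}$ (the paper's notation, rank $2$; Kac's $D_3^{(2)}$): rows $(2,-2,0),(-1,2,-1),(0,-2,2)$. $\Lambda_j$ is the fundamental weight with $\langle\Lambda_j,\alpha_k^\vee\rangle=\delta_{jk}$. $W$ is generated by $\sigma_i(v)=v-\langle v,\alpha_i^\vee\rangle\alpha_i$. $\mathrm{ht}(\sum k_i\alpha_i)=\sum k_i$. In the paper's abacus model, $j$-core abaci of type $X$ correspond bijectively to the elements $\mu=\Lambda_j-\beta$ of $W\Lambda_j$, with height $\mathrm{ht}(\beta)$. $r_2(n)$ is the number of $(x,y)\in\mathbb{Z}^2$ with $x^2+y^2=n$. The sums run over positive divisors $d$. $\chi_4(d)=1$ if $d\equiv1\pmod 4$, $-1$ if $d\equiv-1\pmod4$, and $0$ if $d$ is even. *)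

theory Defs
  imports Complex_Main "HOL-Library.Product_Plus" "HOL-Algebra.Bij" "HOL-Algebra.Generated_Groups"
begin

text \<open>\<open>D22\<close> is \<open>D_2^(2)\<close> in the notation indexed by the rank, that is, Kac's \<open>D_3^(2)\<close>.\<close>

datatype affine_type = C21 | D22

fun cartan :: "affine_type \<Rightarrow> nat \<Rightarrow> nat \<Rightarrow> int" where
  "cartan C21 i k = [[ 2, -1,  0],
                     [-2,  2, -2],
                     [ 0, -1,  2]] ! i ! k"
| "cartan D22 i k = [[ 2, -2,  0],
                     [-1,  2, -1],
                     [ 0, -2,  2]] ! i ! k"

text \<open>
  The type \<open>'v\<close> is the dual Cartan subalgebra over an arbitrary field of characteristic 0.
  The simple coroot \<open>\<alpha>\<^sub>i\<^sup>\<or>\<close> enters as the linear functional \<open>coroot i\<close>, so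
  \<open>coroot i v\<close> is the pairing of \<open>v\<close> with \<open>\<alpha>\<^sub>i\<^sup>\<or>\<close>. Only the indices 0, 1, 2 matter. The
  Cartan matrix is singular, so the \<open>\<alpha> k\<close> must be assumed linearly independent, and the
  \<open>\<Lambda> j\<close> are determined by their pairings only up to a vector annihilated by all coroots;
  neither the dimension of \<open>'v\<close> nor a choice of the \<open>\<Lambda> j\<close> is fixed.
\<close>

locale affine_realization = vector_space scale
  for scale :: "'k::field_char_0 \<Rightarrow> 'v::ab_group_add \<Rightarrow> 'v" (infixr "*s" 75) +
  fixes X :: affine_type
    and \<alpha> :: "nat \<Rightarrow> 'v"
    and coroot :: "nat \<Rightarrow> 'v \<Rightarrow> 'k"
    and \<Lambda> :: "nat \<Rightarrow> 'v"
  assumes linear_coroot: "i \<le> 2 \<Longrightarrow> Vector_Spaces.linear (*s) (*) (coroot i)"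
    and inj_root: "inj_on \<alpha> {..2}"
    and independent_roots: "independent (\<alpha> ` {..2})"
    and coroot_root: "i \<le> 2 \<Longrightarrow> k \<le> 2 \<Longrightarrow> coroot i (\<alpha> k) = of_int (cartan X i k)"
    and coroot_weight: "i \<le> 2 \<Longrightarrow> j \<le> 2 \<Longrightarrow> coroot i (\<Lambda> j) = (if i = j then 1 else 0)"
begin

definition reflection :: "nat \<Rightarrow> 'v \<Rightarrow> 'v" where
  "reflection i v = v - coroot i v *s \<alpha> i"

definition weyl_group :: "('v \<Rightarrow> 'v) set" where
  "weyl_group = generate (BijGroup UNIV) (reflection ` {..2})"

definition weyl_orbit :: "'v \<Rightarrow> 'v set" where
  "weyl_orbit v = (\<lambda>w. w v) ` weyl_group"

text \<open>
  The sum of the coordinates with respect to the simple roots. It is meaningful on the span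
  of the simple roots, which contains \<open>v - w v\<close> for every \<open>v\<close> and every \<open>w \<in> weyl_group\<close>.
\<close>

definition ht :: "'v \<Rightarrow> 'k" where
  "ht v = (\<Sum>i\<le>2. representation (\<alpha> ` {..2}) v (\<alpha> i))"

text \<open>
  The \<open>j\<close>-core abaci of height \<open>N\<close>, each given by the element of the orbit of \<open>\<Lambda> j\<close> to
  which it corresponds.
\<close>

definition cores :: "nat \<Rightarrow> nat \<Rightarrow> 'v set" where
  "cores j N = {\<mu> \<in> weyl_orbit (\<Lambda> j). ht (\<Lambda> j - \<mu>) = of_nat N}"

end

definition r2 :: "nat \<Rightarrow> nat" where
  "r2 n = card {(x :: int, y :: int). x\<^sup>2 + y\<^sup>2 = int n}"

definition chi4 :: "nat \<Rightarrow> int" where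
  "chi4 d = (if d mod 4 = 1 then 1 else if d mod 4 = 3 then -1 else 0)"

text \<open>Both types have a realization, over every field of characteristic 0.\<close>

lemma affine_realization_exists:
  "affine_realization (\<lambda>r::'k::field_char_0. \<lambda>(a, b, c, d). (r * a, r * b, r * c, r * d)) X
     (\<lambda>k. (of_int (cartan X 0 k), of_int (cartan X 1 k), of_int (cartan X 2 k),
           if k = 0 then 1 else 0))
     (\<lambda>i (a, b, c, d). if i = 0 then a else if i = 1 then b else c)
     (\<lambda>j. (if j = 0 then 1 else 0, if j = 1 then 1 else 0, if j = 2 then 1 else 0, 0))"
  (is "affine_realization ?s X ?\<alpha> ?c ?\<Lambda>")
proof -
  interpret vector_space ?s
    by unfold_locales (auto simp: algebra_simps)
  have three: "{..2::nat} = {0, 1, 2}" and le: "\<And>i::nat. i \<le> 2 \<longleftrightarrow> i = 0 \<or> i = 1 \<or> i = 2"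
    by auto
  have inj: "inj_on ?\<alpha> {..2}"
    by (cases X) (auto simp: three)
  have indep: "independent (?\<alpha> ` {..2})"
  proof (rule independent_if_scalars_zero)
    fix f x
    assume "(\<Sum>x\<in>?\<alpha> ` {..2}. ?s (f x) x) = 0" and x: "x \<in> ?\<alpha> ` {..2}"
    then have "(\<Sum>k\<in>{..2}. ?s (f (?\<alpha> k)) (?\<alpha> k)) = 0"
      by (subst (asm) sum.reindex[OF inj]) (simp only: o_def)
    then show "f x = 0"
      using x by (cases X) (auto simp: three zero_prod_def)
  qed simp
  have lin: "Vector_Spaces.linear ?s (*) (?c i)" for i
    by unfold_locales (auto simp: algebra_simps)
  show ?thesis
    by (rule affine_realization.intro, rule vector_space_axioms,
        rule affine_realization_axioms.intro)
      (use lin inj indep in \<open>auto simp: le\<close>)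
qed

end

theory Submission
  imports Defs
begin

text \<open>
  In suitable coordinates \<open>(p, q) \<in> \<int>\<^sup>2\<close> on the weights of a fixed level, the Weyl group acts by
  affine reflections in the sides of a right isosceles triangle, and completing the square in
  the height gives \<open>(m p - 1)\<^sup>2 + (m q - 1)\<^sup>2\<close> with \<open>m = 4\<close> for \<open>C21\<close> and \<open>m = 3\<close> for \<open>D22\<close>. The
  orbits of \<open>\<Lambda> 0\<close>, \<open>\<Lambda> 1\<close>, \<open>\<Lambda> 2\<close> are cut out by the parities of \<open>p\<close> and \<open>q\<close>, so cores correspond to
  representations as a sum of two squares up to signs and, for \<open>j \<noteq> 1\<close>, up to order.

  Jacobi's formula for \<open>r2 n\<close> reduces to \<open>n mod 4 = 1\<close>, where \<open>r2 n\<close> counts the pairs of odd \<open>x\<close>,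
  \<open>y\<close> with \<open>x\<^sup>2 + y\<^sup>2 = 2 n\<close>. For \<open>s = 2 n + 1\<close> the symmetry of \<open>x\<^sup>2 + y\<^sup>2 + z\<^sup>2 = s\<close> gives a
  recurrence: these counts, at \<open>(s - k\<^sup>2) / 2\<close> and weighted by \<open>s - 3 k\<^sup>2\<close>, sum to 0 over odd \<open>k\<close>.
  The divisor sums of the character satisfy the same recurrence, by an involution in the style of
  Liouville on the solutions of \<open>k\<^sup>2 + 2 d e = s\<close>.
\<close>

section \<open>Jacobi's two-square theorem\<close>

lemma sum_sign_reversing_involution:
  fixes g :: "'a \<Rightarrow> int"
  assumes "\<And>x. x \<in> A \<Longrightarrow> f x \<in> A" "\<And>x. x \<in> A \<Longrightarrow> f (f x) = x"
    and "\<And>x. x \<in> A \<Longrightarrow> g (f x) = - g x"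
  shows "sum g A = 0"
proof -
  have "sum g A = sum (\<lambda>x. - g x) A"
    by (rule sum.reindex_bij_witness[of A f f]) (use assms in force)+
  then show ?thesis
    by (simp add: sum_negf)
qed

section \<open>The character modulo 4 and an involution of Liouville type\<close>

definition chi :: "int \<Rightarrow> int" where
  "chi i = (if i mod 4 = 1 then 1 else if i mod 4 = 3 then -1 else 0)"

lemma chi_of_nat: "chi (int d) = chi4 d"
  unfolding chi_def chi4_def by presburger

lemma chi_diff_4: "4 dvd a - b \<Longrightarrow> chi a = chi b"
  unfolding chi_def by presburger

lemma chi_minus: "chi (- a) = - chi a"
  unfolding chi_def by presburger

lemma chi_even: "even a \<Longrightarrow> chi a = 0"
  unfolding chi_def by presburger

definition triples :: "int \<Rightarrow> (int \<times> int \<times> int) set" where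
  "triples s = {(k, d, e). odd k \<and> odd d \<and> odd e \<and> 0 < d \<and> 0 < e \<and> k\<^sup>2 + 2 * d * e = s}"

text \<open>
  The first case fixes \<open>e\<close> and \<open>k + d\<close> and negates \<open>k - e\<close>; the other two fix \<open>k - e\<close> and either
  negate \<open>k + d\<close> or fix it and turn \<open>e\<close> into \<open>-e\<close> modulo 4. So \<open>chi e * ((k - e) * (k + d))\<close>
  changes sign in every case.
\<close>

definition liouville :: "int \<times> int \<times> int \<Rightarrow> int \<times> int \<times> int" where
  "liouville = (\<lambda>(k, d, e).
     if 2 * e < d + 2 * k then (2 * e - k, d + 2 * k - 2 * e, e)
     else if 2 * (k + d) < e then (- k - 2 * d, d, e - 2 * k - 2 * d)
     else (3 * k + 2 * d - 2 * e, 2 * e - 2 * k - d, 2 * d + 2 * k - e))"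

text \<open>The boundaries between the three cases are never met because \<open>d\<close> and
  \<open>e\<close> are odd. The inequalities defining a case are what keeps the new \<open>d\<close>
  and \<open>e\<close> positive, and each case is mapped to itself.\<close>

lemma liouville_triples:
  assumes "t \<in> triples s"
  shows "liouville t \<in> triples s" "liouville (liouville t) = t"
proof -
  obtain k d e where t: "t = (k, d, e)" by (cases t)
  have *: "odd k" "odd d" "odd e" "0 < d" "0 < e" and s: "k\<^sup>2 + 2 * d * e = s"
    using assms by (auto simp: t triples_def)
  have ne: "2 * e \<noteq> d + 2 * k" "2 * (k + d) \<noteq> e"
    using * by presburger+
  show "liouville t \<in> triples s"
    using * ne s by (auto simp: t liouville_def triples_def power2_eq_square algebra_simps)
  show "liouville (liouville t) = t"
    using * ne by (auto simp: t liouville_def)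
qed

text \<open>On \<open>triples s\<close> the weight \<open>s - 3 * k^2\<close> equals
  \<open>2 * (d * e - k^2)\<close>, which is twice the difference of \<open>k * (d - e)\<close> and
  \<open>(k - e) * (k + d)\<close>. The first part cancels under \<open>k\<close> to
  \<open>-k\<close>, the second under \<open>liouville\<close>.\<close>

lemma sum_triples_chi: "(\<Sum>(k, d, e)\<in>triples s. chi e * (s - 3 * k\<^sup>2)) = 0"
proof -
  have "(\<Sum>(k, d, e)\<in>triples s. chi e * ((k - e) * (k + d))) = 0"
  proof (rule sum_sign_reversing_involution[of _ liouville])
    fix t assume A: "t \<in> triples s"
    then obtain k d e where t: "t = (k, d, e)" and *: "odd k" "odd d" "odd e"
      by (auto simp: triples_def)
    \<comment> \<open>\<open>k + d\<close> is even, so \<open>2 * k + 2 * d\<close> vanishes modulo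
      4.\<close>
    have 1: "chi (e - 2 * k - 2 * d) = chi e"
      by (rule chi_diff_4) (use * in presburger)
    have "chi (2 * d + 2 * k - e) = chi (- e)"
      by (rule chi_diff_4) (use * in presburger)
    then have 2: "chi (2 * d + 2 * k - e) = - chi e"
      by (simp add: chi_minus)
    show "(\<lambda>(k, d, e). chi e * ((k - e) * (k + d))) (liouville t) =
        - (\<lambda>(k, d, e). chi e * ((k - e) * (k + d))) t"
      unfolding t liouville_def prod.case if_distrib[of "\<lambda>t. case t of (k, d, e) \<Rightarrow> chi e * ((k - e) * (k + d))"] 1 2
      by (simp add: algebra_simps)
  qed (simp_all add: liouville_triples)
  moreover have "(\<Sum>(k, d, e)\<in>triples s. chi e * (k * (d - e))) = 0"
    by (rule sum_sign_reversing_involution[of _ "\<lambda>(k, d, e). (- k, d, e)"])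
      (auto simp: triples_def)
  moreover have "(\<Sum>(k, d, e)\<in>triples s. chi e * (s - 3 * k\<^sup>2)) =
      (\<Sum>t\<in>triples s. 2 * (case t of (k, d, e) \<Rightarrow> chi e * (k * (d - e)))
         - 2 * (case t of (k, d, e) \<Rightarrow> chi e * ((k - e) * (k + d))))"
    by (rule sum.cong) (auto simp: triples_def algebra_simps power2_eq_square)
  ultimately show ?thesis
    by (simp add: sum_subtractf flip: sum_distrib_left)
qed

section \<open>Two recurrences with the same weights\<close>

definition chi_sum :: "int \<Rightarrow> int" where
  "chi_sum n = (\<Sum>e | 0 < e \<and> e dvd n. chi e)"

definition odd_reps :: "int \<Rightarrow> (int \<times> int) set" where
  "odd_reps n = {(x, y). odd x \<and> odd y \<and> x\<^sup>2 + y\<^sup>2 = n}"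

lemma abs_le_of_square_le:
  fixes x n :: int
  assumes "x\<^sup>2 \<le> n"
  shows "x \<in> {-n..n}"
proof -
  have "\<bar>x\<bar> * 1 \<le> \<bar>x\<bar> * \<bar>x\<bar>"
    by (cases "x = 0", simp) (rule mult_left_mono, linarith+)
  then have "\<bar>x\<bar> \<le> x\<^sup>2" by (simp add: power2_eq_square)
  then show ?thesis using assms by auto
qed

lemma finite_sum_two_squares: "finite {(x :: int, y :: int). x\<^sup>2 + y\<^sup>2 = n}"
proof (rule finite_subset)
  show "{(x :: int, y :: int). x\<^sup>2 + y\<^sup>2 = n} \<subseteq> {-n..n} \<times> {-n..n}"
  proof clarify
    fix x y :: int assume n: "n = x\<^sup>2 + y\<^sup>2"
    show "x \<in> {-(x\<^sup>2 + y\<^sup>2)..x\<^sup>2 + y\<^sup>2} \<and> y \<in> {-(x\<^sup>2 + y\<^sup>2)..x\<^sup>2 + y\<^sup>2}"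
      using abs_le_of_square_le[of x "x\<^sup>2 + y\<^sup>2"] abs_le_of_square_le[of y "x\<^sup>2 + y\<^sup>2"] by simp
  qed
qed simp

lemma finite_odd_reps: "finite (odd_reps n)"
  by (rule finite_subset[OF _ finite_sum_two_squares[of n]]) (auto simp: odd_reps_def)

lemma finite_pos_divisors: "0 < n \<Longrightarrow> finite {e. 0 < e \<and> e dvd (n :: int)}"
  by (rule finite_subset[of _ "{0..n}"]) (auto dest: zdvd_imp_le)

definition odd_roots :: "int \<Rightarrow> int set" where
  "odd_roots s = {k. odd k \<and> k\<^sup>2 < s}"

lemma finite_odd_roots: "finite (odd_roots s)"
  by (rule finite_subset[of _ "{-s..s}"]) (auto simp: odd_roots_def dest!: less_imp_le abs_le_of_square_le)

lemma odd_square_mod_8: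
  fixes k :: int
  assumes "odd k"
  obtains a where "k\<^sup>2 = 8 * a + 1"
proof -
  obtain m where "k = 2 * m + 1" using assms by (elim oddE)
  then have "k\<^sup>2 = 4 * (m * (m + 1)) + 1" by (simp add: power2_eq_square algebra_simps)
  moreover obtain a where "m * (m + 1) = 2 * a" by (rule evenE[of "m * (m + 1)"]) auto
  ultimately show ?thesis using that[of a] by simp
qed

text \<open>For fixed \<open>k\<close> the triples are the factorizations \<open>d * e\<close> of
  \<open>(s - k^2) div 2\<close>. Odd squares are 1 modulo 8, so \<open>s mod 8 = 3\<close> makes
  this number odd, and all its divisors are odd as \<open>triples\<close> demands.\<close>

lemma chi_sum_recurrence:
  assumes "s mod 8 = 3"
  shows "(\<Sum>k\<in>odd_roots s. (s - 3 * k\<^sup>2) * chi_sum ((s - k\<^sup>2) div 2)) = 0"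
proof -
  have fin: "finite {e. 0 < e \<and> e dvd (s - k\<^sup>2) div 2}" if "k \<in> odd_roots s" for k
  proof -
    have "odd k" using that by (simp add: odd_roots_def)
    then obtain a where "k\<^sup>2 = 8 * a + 1" by (rule odd_square_mod_8)
    moreover have "k\<^sup>2 < s" using that by (simp add: odd_roots_def)
    ultimately have "0 < (s - k\<^sup>2) div 2" using assms by presburger
    then show ?thesis by (rule finite_pos_divisors)
  qed
  have "(\<Sum>k\<in>odd_roots s. (s - 3 * k\<^sup>2) * chi_sum ((s - k\<^sup>2) div 2)) =
      (\<Sum>(k, e)\<in>Sigma (odd_roots s) (\<lambda>k. {e. 0 < e \<and> e dvd (s - k\<^sup>2) div 2}).
         chi e * (s - 3 * k\<^sup>2))"
    using fin finite_odd_roots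
    by (subst sum.Sigma[symmetric]) (auto simp: chi_sum_def sum_distrib_left mult.commute)
  also have "\<dots> = (\<Sum>(k, d, e)\<in>triples s. chi e * (s - 3 * k\<^sup>2))"
  proof (rule sum.reindex_bij_witness[of _ "\<lambda>(k, d, e). (k, e)"
        "\<lambda>(k, e). (k, (s - k\<^sup>2) div 2 div e, e)"])
    fix t assume "t \<in> Sigma (odd_roots s) (\<lambda>k. {e. 0 < e \<and> e dvd (s - k\<^sup>2) div 2})"
    then obtain k e where t: "t = (k, e)" and k: "odd k" "k\<^sup>2 < s" and e: "0 < e"
      and dvd: "e dvd (s - k\<^sup>2) div 2"
      by (auto simp: odd_roots_def)
    obtain d where d: "(s - k\<^sup>2) div 2 = e * d" using dvd by (elim dvdE)
    obtain a where a: "k\<^sup>2 = 8 * a + 1" using k(1) by (rule odd_square_mod_8)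
    have "0 < r \<and> odd r \<and> s = 8 * a + 1 + 2 * r" if "(s - (8 * a + 1)) div 2 = r" for r
      using that assms k(2) unfolding a by presburger
    from this[of "e * d"] have "0 < e * d" "odd (e * d)" "s = k\<^sup>2 + 2 * (e * d)"
      using d by (simp_all add: a)
    then show "(\<lambda>(k, e). (k, (s - k\<^sup>2) div 2 div e, e)) t \<in> triples s"
      using e k unfolding t triples_def by (auto simp: d zero_less_mult_iff)
  qed (auto simp: triples_def odd_roots_def)
  finally show ?thesis by (simp add: sum_triples_chi)
qed

text \<open>On \<open>x^2 + y^2 + z^2 = s\<close> the weight splits as
  \<open>(x^2 - z^2) + (y^2 - z^2)\<close>, and each summand changes sign under a transposition of
  coordinates.\<close>

lemma odd_reps_recurrence:
  "(\<Sum>k\<in>odd_roots s. (s - 3 * k\<^sup>2) * int (card (odd_reps (s - k\<^sup>2)))) = 0"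
proof -
  define Q where "Q = {(z :: int, x :: int, y :: int). odd x \<and> odd y \<and> odd z \<and> x\<^sup>2 + y\<^sup>2 + z\<^sup>2 = s}"
  have "(\<Sum>k\<in>odd_roots s. (s - 3 * k\<^sup>2) * int (card (odd_reps (s - k\<^sup>2)))) =
      (\<Sum>(z, w)\<in>Sigma (odd_roots s) (\<lambda>k. odd_reps (s - k\<^sup>2)). s - 3 * z\<^sup>2)"
    using finite_odd_reps finite_odd_roots
    by (subst sum.Sigma[symmetric]) (auto simp: mult.commute)
  also have "Sigma (odd_roots s) (\<lambda>k. odd_reps (s - k\<^sup>2)) = Q"
    by (auto simp: Q_def odd_roots_def odd_reps_def algebra_simps sum_power2_gt_zero_iff)
  also have "(\<Sum>(z, w)\<in>Q. s - 3 * z\<^sup>2) = (\<Sum>(z, x, y)\<in>Q. x\<^sup>2 - z\<^sup>2) + (\<Sum>(z, x, y)\<in>Q. y\<^sup>2 - z\<^sup>2)"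
    unfolding sum.distrib[symmetric] by (rule sum.cong) (auto simp: Q_def)
  also have "(\<Sum>(z, x, y)\<in>Q. x\<^sup>2 - z\<^sup>2) = 0"
    by (rule sum_sign_reversing_involution[of _ "\<lambda>(z, x, y). (x, z, y)"]) (auto simp: Q_def)
  also have "(\<Sum>(z, x, y)\<in>Q. y\<^sup>2 - z\<^sup>2) = 0"
    by (rule sum_sign_reversing_involution[of _ "\<lambda>(z, x, y). (y, x, z)"]) (auto simp: Q_def)
  finally show ?thesis by simp
qed

text \<open>The two recurrences at \<open>s = 2 * n + 1\<close> are subtracted. By induction the
  difference vanishes at every \<open>k\<close> other than 1 and -1, where
  \<open>(s - k^2) div 2\<close> is \<open>n\<close> itself. These two terms carry the weight
  \<open>2 * (n - 1)\<close>, so the value at \<open>n\<close> is determined unless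
  \<open>n = 1\<close>.\<close>

lemma card_odd_reps:
  fixes n :: int
  assumes "0 < n" "n mod 4 = 1"
  shows "int (card (odd_reps (2 * n))) = 4 * chi_sum n"
  using assms
proof (induction "nat n" arbitrary: n rule: less_induct)
  case less
  define D where "D k = int (card (odd_reps (2 * n + 1 - k\<^sup>2))) - 4 * chi_sum ((2 * n + 1 - k\<^sup>2) div 2)"
    for k
  have s: "(2 * n + 1) mod 8 = 3" using less.prems by presburger
  have "(\<Sum>k\<in>odd_roots (2 * n + 1). (2 * n + 1 - 3 * k\<^sup>2) * D k) =
      (\<Sum>k\<in>odd_roots (2 * n + 1). (2 * n + 1 - 3 * k\<^sup>2) * int (card (odd_reps (2 * n + 1 - k\<^sup>2))))
      - 4 * (\<Sum>k\<in>odd_roots (2 * n + 1). (2 * n + 1 - 3 * k\<^sup>2) * chi_sum ((2 * n + 1 - k\<^sup>2) div 2))"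
    by (simp add: D_def sum_distrib_left sum_subtractf[symmetric] algebra_simps)
  also have "\<dots> = 0"
    using chi_sum_recurrence[OF s] odd_reps_recurrence[of "2 * n + 1"] by simp
  finally have 0: "(\<Sum>k\<in>odd_roots (2 * n + 1). (2 * n + 1 - 3 * k\<^sup>2) * D k) = 0" .
  have "D k = 0" if k: "k \<in> odd_roots (2 * n + 1) - {1, -1}" for k
  proof -
    have k': "odd k" "k\<^sup>2 < 2 * n + 1" "k \<noteq> 1" "k \<noteq> -1" using k by (auto simp: odd_roots_def)
    have "k\<^sup>2 \<noteq> 1" using k' by (simp add: power2_eq_1_iff)
    moreover have "0 < k\<^sup>2" using k'(1) by auto
    moreover obtain a where "k\<^sup>2 = 8 * a + 1" using k'(1) by (rule odd_square_mod_8)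
    ultimately have "nat ((2 * n + 1 - k\<^sup>2) div 2) < nat n" "0 < (2 * n + 1 - k\<^sup>2) div 2"
      "(2 * n + 1 - k\<^sup>2) div 2 mod 4 = 1" "2 * ((2 * n + 1 - k\<^sup>2) div 2) = 2 * n + 1 - k\<^sup>2"
      using k'(2) less.prems by simp_all presburger+
    from less.hyps[OF this(1-3)] this(4) show ?thesis by (simp add: D_def)
  qed
  then have "(\<Sum>k\<in>odd_roots (2 * n + 1). (2 * n + 1 - 3 * k\<^sup>2) * D k) =
      (\<Sum>k\<in>{1, -1}. (2 * n + 1 - 3 * k\<^sup>2) * D k)"
    by (intro sum.mono_neutral_right finite_odd_roots) (use less.prems in \<open>auto simp: odd_roots_def\<close>)
  with 0 have *: "(n - 1) * (int (card (odd_reps (2 * n))) - 4 * chi_sum n) = 0"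
    by (simp add: D_def algebra_simps)
  show ?case
  proof (cases "n = 1")
    case True
    \<comment> \<open>Here the weight vanishes and the recurrence says nothing, so this start of the
      induction is computed directly.\<close>
    have "odd_reps 2 = {(1, 1), (1, -1), (-1, 1), (-1, -1)}" (is "?A = ?B")
    proof
      show "?A \<subseteq> ?B"
      proof
        fix t assume "t \<in> ?A"
        then obtain x y where t: "t = (x, y)" "odd x" "odd y" "x\<^sup>2 + y\<^sup>2 = 2"
          by (auto simp: odd_reps_def)
        then have "0 < x\<^sup>2" "0 < y\<^sup>2" by auto
        with t have "x\<^sup>2 = 1" "y\<^sup>2 = 1" by linarith+
        then show "t \<in> ?B" by (auto simp: t power2_eq_1_iff)
      qed
    qed (auto simp: odd_reps_def)
    moreover have "{e. 0 < e \<and> e dvd (1 :: int)} = {1}" by auto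
    ultimately show ?thesis using True by (simp add: chi_sum_def chi_def)
  qed (use * in simp)
qed

section \<open>From odd representations to Jacobi's formula\<close>

lemma r2_double: "r2 (2 * n) = r2 n"
  unfolding r2_def
\<comment> \<open>Up to conjugation and a unit, the map is multiplication by 1 + i in the Gaussian
  integers. Its inverse is integral because \<open>x\<close> and \<open>y\<close> have equal parity
  when the sum of their squares is even.\<close>
proof (rule bij_betw_same_card[symmetric],
    rule bij_betwI[of "\<lambda>(x, y). (x + y, x - y)" _ _ "\<lambda>(x, y). ((x + y) div 2, (x - y) div 2)"])
  show "(\<lambda>(x, y). ((x + y) div 2, (x - y) div 2))
      \<in> {(x :: int, y). x\<^sup>2 + y\<^sup>2 = int (2 * n)} \<rightarrow> {(x, y). x\<^sup>2 + y\<^sup>2 = int n}"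
  proof clarify
    fix x y :: int assume n: "x\<^sup>2 + y\<^sup>2 = int (2 * n)"
    have "even (x + y)" using arg_cong[OF n, of even] by simp
    then obtain u where "x + y = 2 * u" by (elim evenE)
    then have x: "x = 2 * u - y" by simp
    show "((x + y) div 2)\<^sup>2 + ((x - y) div 2)\<^sup>2 = int n"
      using n by (simp add: x power2_eq_square algebra_simps)
  qed
  fix t :: "int \<times> int" assume "t \<in> {(x, y). x\<^sup>2 + y\<^sup>2 = int (2 * n)}"
  then obtain x y where t: "t = (x, y)" and n: "x\<^sup>2 + y\<^sup>2 = int (2 * n)" by auto
  have "even (x + y)" using arg_cong[OF n, of even] by simp
  then have "(x + y) div 2 + (x - y) div 2 = x" "(x + y) div 2 - (x - y) div 2 = y"
    by presburger+
  then show "(case case t of (x, y) \<Rightarrow> ((x + y) div 2, (x - y) div 2) of (x, y) \<Rightarrow> (x + y, x - y)) = t"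
    by (simp add: t)
qed (auto simp: power2_eq_square algebra_simps)

lemma square_mod_4:
  fixes x :: int
  obtains a where "even x" "x\<^sup>2 = 4 * a" | a where "odd x" "x\<^sup>2 = 4 * a + 1"
proof (cases "even x")
  case True
  then show ?thesis using that(1) by (auto elim!: evenE simp: power2_eq_square)
next
  case False
  then obtain a where "x\<^sup>2 = 8 * a + 1" by (rule odd_square_mod_8)
  then show ?thesis using False that(2)[of "2 * a"] by simp
qed

text \<open>Doubling \<open>n\<close> makes the sum of squares 2 modulo 4, which forces both squares
  to be odd.\<close>

lemma r2_eq_odd_reps:
  assumes "n mod 4 = 1"
  shows "r2 n = card (odd_reps (2 * int n))"
proof -
  have "{(x :: int, y :: int). x\<^sup>2 + y\<^sup>2 = int (2 * n)} = odd_reps (2 * int n)"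
  proof -
    have "odd x \<and> odd y" if n: "x\<^sup>2 + y\<^sup>2 = 2 * int n" for x y
      by (rule square_mod_4[of x]; rule square_mod_4[of y]; use n assms in \<open>simp; presburger\<close>)
    then show ?thesis by (auto simp: odd_reps_def)
  qed
  then show ?thesis
    using r2_double[of n] by (simp add: r2_def)
qed

lemma r2_eq_0:
  assumes "n mod 4 = 3"
  shows "r2 n = 0"
proof -
  have "x\<^sup>2 + y\<^sup>2 \<noteq> int n" for x y :: int
    by (rule square_mod_4[of x]; rule square_mod_4[of y]; use assms in \<open>simp; presburger\<close>)
  then show ?thesis by (simp add: r2_def)
qed

lemma chi_mult: "chi (a * b) = chi a * chi b"
proof -
  have "a mod 4 \<in> {0, 1, 2, 3}" "b mod 4 \<in> {0, 1, 2, 3}" by auto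
  then show ?thesis
    unfolding chi_def mod_mult_eq[of a 4 b, symmetric] by auto
qed

text \<open>Complementary divisors cancel, since
  \<open>chi e * chi (n div e) = chi n = -1\<close>.\<close>

lemma chi_sum_eq_0:
  assumes "0 < n" "n mod 4 = 3"
  shows "chi_sum n = 0"
  unfolding chi_sum_def
proof (rule sum_sign_reversing_involution[of _ "\<lambda>e. n div e"])
  fix e assume "e \<in> {e. 0 < e \<and> e dvd n}"
  then obtain f where n: "n = e * f" and "0 < e" by auto
  then have f: "n div e = f" "0 < f" using assms(1) by (auto simp: zero_less_mult_iff)
  show "n div e \<in> {e. 0 < e \<and> e dvd n}" "n div (n div e) = e"
    using f \<open>0 < e\<close> n by auto
  have "chi (e * f) = -1" using assms(2) by (simp add: n chi_def)
  then have "chi e * chi f = -1" by (simp add: chi_mult)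
  moreover have "chi e \<in> {-1, 0, 1}" by (simp add: chi_def)
  ultimately show "chi (n div e) = - chi e"
    unfolding f by auto
qed

text \<open>An odd divisor of \<open>2 * n\<close> already divides \<open>n\<close>, so the
  additional divisors are even and \<open>chi\<close> vanishes on them.\<close>

lemma chi_sum_double:
  assumes "0 < n"
  shows "chi_sum (2 * n) = chi_sum n"
  unfolding chi_sum_def
proof (rule sum.mono_neutral_right)
  show "\<forall>e\<in>{e. 0 < e \<and> e dvd 2 * n} - {e. 0 < e \<and> e dvd n}. chi e = 0"
    by (auto intro!: chi_even) (metis coprime_commute coprime_dvd_mult_right_iff coprime_right_2_iff_odd)
qed (use assms in \<open>auto intro: finite_pos_divisors\<close>)

theorem jacobi_two_squares:
  assumes "0 < n"
  shows "real (r2 n) = 4 * (\<Sum>d | d dvd n. real_of_int (chi4 d))"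
proof -
  have "int (r2 n) = 4 * chi_sum (int n)"
    using assms
  proof (induction n rule: less_induct)
    case (less n)
    consider m where "n = 2 * m" | "n mod 4 = 1" | "n mod 4 = 3"
    proof (cases "even n")
      case False
      then have "n mod 4 = 1 \<or> n mod 4 = 3" by presburger
      then show ?thesis using that(2,3) by blast
    qed (use that(1) in \<open>auto elim!: evenE\<close>)
    then show ?case
    proof cases
      case 1
      then show ?thesis using less by (simp add: r2_double chi_sum_double)
    next
      case 2
      then have "int n mod 4 = 1" by presburger
      then show ?thesis
        using 2 less.prems by (simp add: r2_eq_odd_reps card_odd_reps)
    next
      case 3
      then have "int n mod 4 = 3" by presburger
      then show ?thesis
        using 3 less.prems by (simp add: r2_eq_0 chi_sum_eq_0)
    qed
  qed
  also have "chi_sum (int n) = (\<Sum>d | d dvd n. chi4 d)"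
  proof -
    have "{e. 0 < e \<and> e dvd int n} = int ` {d. d dvd n}"
    proof (intro equalityI subsetI)
      fix e assume "e \<in> {e. 0 < e \<and> e dvd int n}"
      then have "e = int (nat e)" "nat e dvd n" by (auto simp: nat_dvd_iff)
      then show "e \<in> int ` {d. d dvd n}" by blast
    next
      fix e assume "e \<in> int ` {d. d dvd n}"
      then show "e \<in> {e. 0 < e \<and> e dvd int n}"
        using assms by (auto intro: dvd_pos_nat)
    qed
    then show ?thesis by (simp add: chi_sum_def sum.reindex chi_of_nat)
  qed
  finally have "real_of_int (int (r2 n)) = real_of_int (4 * (\<Sum>d | d dvd n. chi4 d))"
    by (rule arg_cong)
  then show ?thesis by simp
qed

section \<open>Orbits of fundamental weights\<close>

text \<open>The triple \<open>(a, b, c)\<close> encodes the weight \<open>\<Lambda> j - a \<alpha> 0 - b \<alpha> 1 - c \<alpha> 2\<close>.\<close>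

definition coroot_value :: "affine_type \<Rightarrow> nat \<Rightarrow> nat \<Rightarrow> int \<times> int \<times> int \<Rightarrow> int" where
  "coroot_value X j i = (\<lambda>(a, b, c). (if i = j then 1 else 0)
     - (cartan X i 0 * a + cartan X i 1 * b + cartan X i 2 * c))"

text \<open>A simple reflection subtracts the pairing times \<open>\<alpha> i\<close>, that is, adds
  the pairing to one entry of the triple. The closure of the zero triple under these moves describes
  the orbit over the integers, whatever the field.\<close>

inductive_set root_coords :: "affine_type \<Rightarrow> nat \<Rightarrow> (int \<times> int \<times> int) set"
  for X :: affine_type and j :: nat
where
  zero: "(0, 0, 0) \<in> root_coords X j"
| refl0: "(a, b, c) \<in> root_coords X j \<Longrightarrow> (a + coroot_value X j 0 (a, b, c), b, c) \<in> root_coords X j"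
| refl1: "(a, b, c) \<in> root_coords X j \<Longrightarrow> (a, b + coroot_value X j 1 (a, b, c), c) \<in> root_coords X j"
| refl2: "(a, b, c) \<in> root_coords X j \<Longrightarrow> (a, b, c + coroot_value X j 2 (a, b, c)) \<in> root_coords X j"

section \<open>The Weyl group action in integer root coordinates\<close>

context affine_realization
begin

lemma coroot_add: "i \<le> 2 \<Longrightarrow> coroot i (v + w) = coroot i v + coroot i w"
  using linear_coroot[of i] by (simp add: Vector_Spaces.linear_iff)

lemma coroot_scale: "i \<le> 2 \<Longrightarrow> coroot i (r *s v) = r * coroot i v"
  using linear_coroot[of i] by (simp add: Vector_Spaces.linear_iff)

lemma coroot_diff: "i \<le> 2 \<Longrightarrow> coroot i (v - w) = coroot i v - coroot i w"
  using coroot_add[of i "v - w" w] by simp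

lemma reflection_reflection: "i \<le> 2 \<Longrightarrow> reflection i (reflection i v) = v"
proof -
  assume i: "i \<le> 2"
  then have "i = 0 \<or> i = 1 \<or> i = 2" by auto
  then have "cartan X i i = 2" by (cases X) auto
  then show ?thesis
    using i by (simp add: reflection_def coroot_diff coroot_scale coroot_root scale_left_diff_distrib[symmetric])
qed

lemma reflection_in_Bij: "reflection ` {..2} \<subseteq> carrier (BijGroup UNIV)"
proof clarify
  fix i :: nat assume "i \<le> 2"
  then have "bij (reflection i)"
    by (intro o_bij[of "reflection i"]) (auto simp: fun_eq_iff reflection_reflection)
  then show "reflection i \<in> carrier (BijGroup UNIV)"
    by (simp add: BijGroup_def Bij_def)
qed

lemma mult_BijGroup_UNIV:
  "f \<in> carrier (BijGroup UNIV) \<Longrightarrow> g \<in> carrier (BijGroup UNIV) \<Longrightarrow> f \<otimes>\<^bsub>BijGroup UNIV\<^esub> g = f \<circ> g"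
  by (simp add: BijGroup_def compose_def fun_eq_iff)

lemma one_BijGroup_UNIV: "\<one>\<^bsub>BijGroup UNIV\<^esub> = (\<lambda>x. x)"
  by (simp add: BijGroup_def fun_eq_iff)

lemma weyl_orbit_self: "v \<in> weyl_orbit v"
  unfolding weyl_orbit_def weyl_group_def
  by (rule image_eqI[OF _ generate.one]) (simp add: one_BijGroup_UNIV)

lemma weyl_group_in_Bij: "weyl_group \<subseteq> carrier (BijGroup UNIV)"
  unfolding weyl_group_def
  by (rule group.generate_incl[OF group_BijGroup reflection_in_Bij])

lemma weyl_orbit_reflection:
  assumes "u \<in> weyl_orbit v" "i \<le> 2"
  shows "reflection i u \<in> weyl_orbit v"
proof -
  obtain w where w: "w \<in> weyl_group" "u = w v" using assms(1) by (auto simp: weyl_orbit_def)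
  have r: "reflection i \<in> weyl_group"
    unfolding weyl_group_def by (rule generate.incl) (use assms(2) in auto)
  have "reflection i \<otimes>\<^bsub>BijGroup UNIV\<^esub> w \<in> weyl_group"
    using r w(1) unfolding weyl_group_def by (rule generate.eng)
  then have "reflection i \<circ> w \<in> weyl_group"
    using r w(1) weyl_group_in_Bij by (subst (asm) mult_BijGroup_UNIV) auto
  then show ?thesis unfolding weyl_orbit_def by (rule image_eqI[rotated]) (simp add: w(2))
qed

text \<open>Simple reflections are their own inverses, so closure under them alone gives closure
  under the group they generate.\<close>

lemma weyl_orbit_subset:
  assumes "v \<in> A" and A: "\<And>i u. i \<le> 2 \<Longrightarrow> u \<in> A \<Longrightarrow> reflection i u \<in> A"
  shows "weyl_orbit v \<subseteq> A"
proof -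
  have "\<forall>u\<in>A. w u \<in> A" if "w \<in> weyl_group" for w
    using that unfolding weyl_group_def
  proof (induction rule: generate.induct)
    case one
    then show ?case by (simp add: one_BijGroup_UNIV)
  next
    case (incl h)
    then show ?case using A by auto
  next
    case (inv h)
    then obtain i where i: "i \<le> 2" "h = reflection i" by auto
    have h: "h \<in> carrier (BijGroup UNIV)" using inv reflection_in_Bij by auto
    have "h \<otimes>\<^bsub>BijGroup UNIV\<^esub> h = \<one>\<^bsub>BijGroup UNIV\<^esub>"
      unfolding mult_BijGroup_UNIV[OF h h] one_BijGroup_UNIV
      by (simp add: fun_eq_iff i reflection_reflection)
    then have "inv\<^bsub>BijGroup UNIV\<^esub> h = h"
      by (rule group.inv_equality[OF group_BijGroup _ h h])
    then show ?case using i A by simp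
  next
    case (eng f g)
    then have "f \<in> carrier (BijGroup UNIV)" "g \<in> carrier (BijGroup UNIV)"
      using weyl_group_in_Bij unfolding weyl_group_def by auto
    then show ?case using eng by (simp add: mult_BijGroup_UNIV)
  qed
  then show ?thesis using assms(1) by (auto simp: weyl_orbit_def)
qed

definition root_comb :: "int \<times> int \<times> int \<Rightarrow> 'v" where
  "root_comb = (\<lambda>(a, b, c). of_int a *s \<alpha> 0 + of_int b *s \<alpha> 1 + of_int c *s \<alpha> 2)"

lemma coroot_weight_minus_root_comb:
  assumes "i \<le> 2" "j \<le> 2"
  shows "coroot i (\<Lambda> j - root_comb t) = of_int (coroot_value X j i t)"
  using assms
  by (cases t) (simp add: root_comb_def coroot_value_def coroot_diff coroot_add coroot_scale
      coroot_root coroot_weight algebra_simps)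

lemma reflection_weight_minus_root_comb:
  assumes "j \<le> 2"
  shows "reflection 0 (\<Lambda> j - root_comb (a, b, c)) =
      \<Lambda> j - root_comb (a + coroot_value X j 0 (a, b, c), b, c)"
    and "reflection 1 (\<Lambda> j - root_comb (a, b, c)) =
      \<Lambda> j - root_comb (a, b + coroot_value X j 1 (a, b, c), c)"
    and "reflection 2 (\<Lambda> j - root_comb (a, b, c)) =
      \<Lambda> j - root_comb (a, b, c + coroot_value X j 2 (a, b, c))"
  unfolding reflection_def
  using assms by (simp_all add: coroot_weight_minus_root_comb)
    (simp_all add: root_comb_def scale_left_distrib algebra_simps)

lemma weyl_orbit_weight:
  assumes "j \<le> 2"
  shows "weyl_orbit (\<Lambda> j) = (\<lambda>t. \<Lambda> j - root_comb t) ` root_coords X j"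
proof
  show "weyl_orbit (\<Lambda> j) \<subseteq> (\<lambda>t. \<Lambda> j - root_comb t) ` root_coords X j"
  proof (rule weyl_orbit_subset)
    show "\<Lambda> j \<in> (\<lambda>t. \<Lambda> j - root_comb t) ` root_coords X j"
      by (rule image_eqI[OF _ root_coords.zero]) (simp add: root_comb_def)
    fix i u assume "i \<le> (2 :: nat)" and "u \<in> (\<lambda>t. \<Lambda> j - root_comb t) ` root_coords X j"
    then obtain a b c where u: "u = \<Lambda> j - root_comb (a, b, c)" and t: "(a, b, c) \<in> root_coords X j"
      and "i = 0 \<or> i = 1 \<or> i = 2"
      by force
    then show "reflection i u \<in> (\<lambda>t. \<Lambda> j - root_comb t) ` root_coords X j"
      using assms root_coords.refl0[OF t] root_coords.refl1[OF t] root_coords.refl2[OF t]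
      by (auto simp only: u reflection_weight_minus_root_comb intro!: imageI)
  qed
  have "\<Lambda> j - root_comb (a, b, c) \<in> weyl_orbit (\<Lambda> j)" if "(a, b, c) \<in> root_coords X j" for a b c
    using that
  proof (induction rule: root_coords.induct)
    case zero
    then show ?case by (simp add: root_comb_def weyl_orbit_self)
  next
    case (refl0 a b c)
    show ?case using weyl_orbit_reflection[OF refl0.IH, of 0] assms
      by (simp add: reflection_weight_minus_root_comb)
  next
    case (refl1 a b c)
    show ?case using weyl_orbit_reflection[OF refl1.IH, of 1] assms
      by (simp only: reflection_weight_minus_root_comb)
  next
    case (refl2 a b c)
    show ?case using weyl_orbit_reflection[OF refl2.IH, of 2] assms
      by (simp add: reflection_weight_minus_root_comb)
  qed
  then show "(\<lambda>t. \<Lambda> j - root_comb t) ` root_coords X j \<subseteq> weyl_orbit (\<Lambda> j)" by auto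
qed

section \<open>Heights and integer triples\<close>

lemma representation_root_comb:
  assumes "i \<le> 2"
  shows "representation (\<alpha> ` {..2}) (root_comb (a, b, c)) (\<alpha> i) =
    of_int (if i = 0 then a else if i = 1 then b else c)"
proof -
  have span: "r *s \<alpha> k \<in> span (\<alpha> ` {..2})" if "k \<le> 2" for r k
    using that by (intro span_scale span_base) auto
  have basis: "representation (\<alpha> ` {..2}) (r *s \<alpha> k) (\<alpha> i) = (if i = k then r else 0)"
    if "k \<le> 2" for r k
    using that assms inj_root
    by (subst representation_scale[OF independent_roots])
      (auto simp: span_base representation_basis[OF independent_roots] inj_on_eq_iff)
  show ?thesis
    using assms span basis
    by (auto simp: root_comb_def representation_add[OF independent_roots] span_add)
qed

lemma ht_root_comb: "ht (root_comb (a, b, c)) = of_int (a + b + c)"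
proof -
  have "{..2::nat} = {0, 1, 2}" by auto
  then have "ht (root_comb (a, b, c)) = (\<Sum>i\<in>{0, 1, 2 :: nat}. of_int (if i = 0 then a else if i = 1 then b else c))"
    unfolding ht_def by (intro sum.cong representation_root_comb) auto
  then show ?thesis by simp
qed

lemma inj_root_comb: "inj root_comb"
proof (rule injI)
  fix s t assume eq: "root_comb s = root_comb t"
  obtain a b c a' b' c' where st: "s = (a, b, c)" "t = (a', b', c')" by (cases s; cases t)
  have "of_int (if i = 0 then a else if i = 1 then b else c) =
      (of_int (if i = 0 then a' else if i = 1 then b' else c') :: 'k)" if "i \<le> 2" for i :: nat
    using representation_root_comb[OF that] eq unfolding st by metis
  from this[of 0] this[of 1] this[of 2] show "s = t" by (simp add: st)
qed

lemma bij_betw_cores: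
  assumes "j \<le> 2"
  shows "bij_betw (\<lambda>t. \<Lambda> j - root_comb t) {(a, b, c) \<in> root_coords X j. a + b + c = int N} (cores j N)"
proof -
  \<comment> \<open>Heights are elements of the field; in characteristic 0 the integers embed
    injectively, so the condition can be read in the integers.\<close>
  have "of_int (a + b + c) = (of_nat N :: 'k) \<longleftrightarrow> a + b + c = int N" for a b c
    by (metis of_int_eq_iff of_int_of_nat_eq)
  then have "cores j N = (\<lambda>t. \<Lambda> j - root_comb t) ` {(a, b, c) \<in> root_coords X j. a + b + c = int N}"
    unfolding cores_def weyl_orbit_weight[OF assms] by (auto simp: ht_root_comb)
  then show ?thesis
    by (auto simp: bij_betw_def inj_on_def dest: injD[OF inj_root_comb])
qed

end

text \<open>
  The pairings with the coroots 0 and 2, halved for \<open>D22\<close> and \<open>j = 1\<close>, where they are even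
  and the level is 2. With this scaling the three reflections are \<open>(-p, q)\<close>, \<open>(1 - q, 1 - p)\<close>
  and \<open>(p, -q)\<close> in all cases.
\<close>

fun alcove_coords :: "affine_type \<Rightarrow> nat \<Rightarrow> int \<times> int \<times> int \<Rightarrow> int \<times> int" where
  "alcove_coords X j (a, b, c) =
     (if X = D22 \<and> j = 1 then (b - a, b - c)
      else (coroot_value X j 0 (a, b, c), coroot_value X j 2 (a, b, c)))"

text \<open>The classes of 0, 1, 2 contain the alcove vertices (1, 0), (0, 0), (0, 1), the
  coordinates of the fundamental weights. They are stable because \<open>(1 - q, 1 - p)\<close>
  swaps the coordinates and flips both parities.\<close>

definition alcove_orbit :: "nat \<Rightarrow> (int \<times> int) set" where
  "alcove_orbit j = {(p, q).
     (if j = 0 then odd p \<and> even q else if j = 1 then even (p + q) else even p \<and> odd q)}"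

lemma alcove_orbit_refl:
  assumes "(p, q) \<in> alcove_orbit j"
  shows "(- p, q) \<in> alcove_orbit j" "(p, - q) \<in> alcove_orbit j" "(1 - q, 1 - p) \<in> alcove_orbit j"
  using assms by (auto simp: alcove_orbit_def split: if_splits)

lemma alcove_coords_refl:
  assumes "j \<le> 2" "alcove_coords X j (a, b, c) = (p, q)"
  shows "alcove_coords X j (a + coroot_value X j 0 (a, b, c), b, c) = (- p, q)"
    and "alcove_coords X j (a, b + coroot_value X j 1 (a, b, c), c) = (1 - q, 1 - p)"
    and "alcove_coords X j (a, b, c + coroot_value X j 2 (a, b, c)) = (p, - q)"
proof -
  have "j = 0 \<or> j = 1 \<or> j = 2" using assms(1) by auto
  then show "alcove_coords X j (a + coroot_value X j 0 (a, b, c), b, c) = (- p, q)"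
    and "alcove_coords X j (a, b + coroot_value X j 1 (a, b, c), c) = (1 - q, 1 - p)"
    and "alcove_coords X j (a, b, c + coroot_value X j 2 (a, b, c)) = (p, - q)"
    using assms(2) by (cases X; elim disjE; simp add: coroot_value_def)+
qed

section \<open>The height as a quadratic form in the coordinates\<close>

fun modulus :: "affine_type \<Rightarrow> int" where
  "modulus C21 = 4" | "modulus D22 = 3"

text \<open>With \<open>m = modulus X\<close>, the affine function of the height \<open>n\<close>
  that matches \<open>(m * p - 1)^2 + (m * q - 1)^2\<close>. Its constants are the values at the
  alcove vertices: 1 + 1 for \<open>j = 1\<close>, otherwise \<open>(m - 1)^2 + 1\<close>.\<close>

fun norm_value :: "affine_type \<Rightarrow> nat \<Rightarrow> int \<Rightarrow> int" where
  "norm_value C21 j n = 16 * n + (if j = 1 then 2 else 10)"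
| "norm_value D22 j n = (if j = 1 then 6 * n + 2 else 12 * n + 5)"

text \<open>The increments on the right are exactly the changes of the quadratic form under the
  three reflections, so its agreement with the height propagates along the orbit.\<close>

lemma norm_value_refl:
  assumes "j \<le> 2" "alcove_coords X j (a, b, c) = (p, q)"
  shows "norm_value X j (n + coroot_value X j 0 (a, b, c)) = norm_value X j n + 4 * modulus X * p"
    and "norm_value X j (n + coroot_value X j 1 (a, b, c)) =
      norm_value X j n + 2 * modulus X * (modulus X - 2) * (1 - p - q)"
    and "norm_value X j (n + coroot_value X j 2 (a, b, c)) = norm_value X j n + 4 * modulus X * q"
proof -
  have "j = 0 \<or> j = 1 \<or> j = 2" using assms(1) by auto
  then show "norm_value X j (n + coroot_value X j 0 (a, b, c)) = norm_value X j n + 4 * modulus X * p"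
    and "norm_value X j (n + coroot_value X j 1 (a, b, c)) =
      norm_value X j n + 2 * modulus X * (modulus X - 2) * (1 - p - q)"
    and "norm_value X j (n + coroot_value X j 2 (a, b, c)) = norm_value X j n + 4 * modulus X * q"
    using assms(2) by (cases X; elim disjE; simp add: coroot_value_def)+
qed

lemma root_coords_alcove:
  assumes "(a, b, c) \<in> root_coords X j" "j \<le> 2"
  shows "case alcove_coords X j (a, b, c) of (p, q) \<Rightarrow> (p, q) \<in> alcove_orbit j \<and>
    (modulus X * p - 1)\<^sup>2 + (modulus X * q - 1)\<^sup>2 = norm_value X j (a + b + c)"
  using assms(1)
proof (induction rule: root_coords.induct)
  case zero
  have "j = 0 \<or> j = 1 \<or> j = 2" using assms(2) by auto
  then show ?case
    by (cases X; elim disjE) (simp_all add: coroot_value_def alcove_orbit_def)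
next
  case (refl0 a b c)
  obtain p q where pq: "alcove_coords X j (a, b, c) = (p, q)" by fastforce
  show ?case
    using refl0.IH norm_value_refl(1)[OF assms(2) pq, of "a + b + c"]
    by (simp add: pq alcove_coords_refl[OF assms(2) pq] alcove_orbit_refl power2_eq_square algebra_simps
        del: alcove_coords.simps)
next
  case (refl1 a b c)
  obtain p q where pq: "alcove_coords X j (a, b, c) = (p, q)" by fastforce
  show ?case
    using refl1.IH norm_value_refl(2)[OF assms(2) pq, of "a + b + c"]
    by (simp add: pq alcove_coords_refl[OF assms(2) pq] alcove_orbit_refl power2_eq_square algebra_simps
        del: alcove_coords.simps One_nat_def)
next
  case (refl2 a b c)
  obtain p q where pq: "alcove_coords X j (a, b, c) = (p, q)" by fastforce
  show ?case
    using refl2.IH norm_value_refl(3)[OF assms(2) pq, of "a + b + c"]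
    by (simp add: pq alcove_coords_refl[OF assms(2) pq] alcove_orbit_refl power2_eq_square algebra_simps
        del: alcove_coords.simps)
qed

text \<open>
  Descent: a pair outside the alcove \<open>p \<ge> 0\<close>, \<open>q \<ge> 0\<close>, \<open>p + q \<le> 1\<close> is moved closer to
  \<open>(1/4, 1/4)\<close> by a reflection, and the alcove contains one integral point of each class.
\<close>

lemma alcove_coords_surj:
  assumes "(p, q) \<in> alcove_orbit j" "j \<le> 2"
  shows "\<exists>t\<in>root_coords X j. alcove_coords X j t = (p, q)"
  using assms
proof (induction "nat ((4 * p - 1)\<^sup>2 + (4 * q - 1)\<^sup>2)" arbitrary: p q rule: less_induct)
  case less
  have j: "j = 0 \<or> j = 1 \<or> j = 2" using less.prems(2) by auto
  have IH: "\<exists>a b c. (a, b, c) \<in> root_coords X j \<and> alcove_coords X j (a, b, c) = (p', q')"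
    if "(p', q') \<in> alcove_orbit j" "(4 * p' - 1)\<^sup>2 + (4 * q' - 1)\<^sup>2 < (4 * p - 1)\<^sup>2 + (4 * q - 1)\<^sup>2" for p' q'
  proof -
    have "nat ((4 * p' - 1)\<^sup>2 + (4 * q' - 1)\<^sup>2) < nat ((4 * p - 1)\<^sup>2 + (4 * q - 1)\<^sup>2)"
      using that(2) by (subst nat_less_eq_zless) auto
    from less.hyps[OF this that(1) less.prems(2)] show ?thesis
      by (auto simp del: alcove_coords.simps)
  qed
  consider "p < 0" | "q < 0" | "p + q > 1" | "0 \<le> p" "0 \<le> q" "p + q \<le> 1" by linarith
  then show ?case
  proof cases
    case 1
    then have "(4 * (- p) - 1)\<^sup>2 + (4 * (q) - 1)\<^sup>2 < (4 * p - 1)\<^sup>2 + (4 * q - 1)\<^sup>2"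
      by (simp add: power2_eq_square algebra_simps)
    then obtain a b c where t: "(a, b, c) \<in> root_coords X j" "alcove_coords X j (a, b, c) = (- p, q)"
      using IH[of "- p" q] alcove_orbit_refl[OF less.prems(1)] by auto
    show ?thesis
      using root_coords.refl0[OF t(1)] alcove_coords_refl(1)[OF less.prems(2) t(2)] by force
  next
    case 2
    then have "(4 * (p) - 1)\<^sup>2 + (4 * (- q) - 1)\<^sup>2 < (4 * p - 1)\<^sup>2 + (4 * q - 1)\<^sup>2"
      by (simp add: power2_eq_square algebra_simps)
    then obtain a b c where t: "(a, b, c) \<in> root_coords X j" "alcove_coords X j (a, b, c) = (p, - q)"
      using IH[of p "- q"] alcove_orbit_refl[OF less.prems(1)] by auto
    show ?thesis
      using root_coords.refl2[OF t(1)] alcove_coords_refl(3)[OF less.prems(2) t(2)] by force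
  next
    case 3
    then have "(4 * (1 - q) - 1)\<^sup>2 + (4 * (1 - p) - 1)\<^sup>2 < (4 * p - 1)\<^sup>2 + (4 * q - 1)\<^sup>2"
      by (simp add: power2_eq_square algebra_simps)
    then obtain a b c where t: "(a, b, c) \<in> root_coords X j" "alcove_coords X j (a, b, c) = (1 - q, 1 - p)"
      using IH[of "1 - q" "1 - p"] alcove_orbit_refl[OF less.prems(1)] by auto
    show ?thesis
      using root_coords.refl1[OF t(1)] alcove_coords_refl(2)[OF less.prems(2) t(2)] by force
  next
    case 4
    then have "p = 0 \<and> q = 0 \<or> p = 1 \<and> q = 0 \<or> p = 0 \<and> q = 1" by linarith
    then have "alcove_coords X j (0, 0, 0) = (p, q)"
      using less.prems(1) j by (cases X) (auto simp: alcove_orbit_def coroot_value_def)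
    then show ?thesis using root_coords.zero by blast
  qed
qed

text \<open>The coordinates do not see the null root, but its height is positive, so they become
  injective once the height is fixed. Conversely, the height of a preimage is recovered from the
  norm, because \<open>norm_value\<close> is injective in its last argument.\<close>

lemma bij_betw_alcove_coords:
  assumes "j \<le> 2"
  shows "bij_betw (alcove_coords X j) {(a, b, c) \<in> root_coords X j. a + b + c = int N}
    {(p, q) \<in> alcove_orbit j. (modulus X * p - 1)\<^sup>2 + (modulus X * q - 1)\<^sup>2 = norm_value X j (int N)}"
    (is "bij_betw _ ?A ?B")
proof (rule bij_betw_imageI)
  have j: "j = 0 \<or> j = 1 \<or> j = 2" using assms by auto
  then show "inj_on (alcove_coords X j) ?A"
    by (cases X) (auto simp: inj_on_def coroot_value_def)
  have inj: "norm_value X j m = norm_value X j n \<Longrightarrow> m = n" for m n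
    by (cases X) (auto split: if_splits)
  show "alcove_coords X j ` ?A = ?B"
  proof (intro equalityI subsetI)
    fix w assume "w \<in> ?B"
    then obtain p q where w: "w = (p, q)" and pq: "(p, q) \<in> alcove_orbit j"
      and N: "(modulus X * p - 1)\<^sup>2 + (modulus X * q - 1)\<^sup>2 = norm_value X j (int N)"
      by auto
    obtain a b c where t: "(a, b, c) \<in> root_coords X j" "alcove_coords X j (a, b, c) = (p, q)"
      using alcove_coords_surj[OF pq assms] by (metis prod_cases3)
    have "a + b + c = int N"
      using root_coords_alcove[OF t(1) assms] N inj unfolding t(2) by simp
    then show "w \<in> alcove_coords X j ` ?A"
      using t unfolding w by (intro image_eqI[of _ _ "(a, b, c)"]) auto
  next
    fix w assume "w \<in> alcove_coords X j ` ?A"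
    then obtain a b c where t: "(a, b, c) \<in> root_coords X j" "w = alcove_coords X j (a, b, c)"
        "a + b + c = int N"
      by auto
    then show "w \<in> ?B"
      using root_coords_alcove[OF t(1) assms] by (cases w) auto
  qed
qed

section \<open>Choosing signs in a sum of two squares\<close>

text \<open>1 and -1 are distinct modulo \<open>m\<close>: opposite signs would give
  \<open>m dvd 2\<close>.\<close>

lemma sign_times_residue_eq:
  fixes m p p' s s' :: int
  assumes "3 \<le> m" "s \<in> {1, -1}" "s' \<in> {1, -1}" "s * (m * p - 1) = s' * (m * p' - 1)"
  shows "s = s' \<and> p = p'"
proof (cases "s = s'")
  case True
  then show ?thesis using assms by auto
next
  case False
  then have "m * (p + p') = 2" using assms(2-4) by (auto simp: algebra_simps)
  then have "m dvd 2" by (metis dvd_triv_left)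
  then show ?thesis using assms(1) by (auto dest: zdvd_imp_le)
qed

text \<open>Each coordinate is, in a unique way, a sign times a number that is -1 modulo
  \<open>m\<close>; every pair of such numbers therefore accounts for four representations.\<close>

lemma r2_eq_card_residues:
  fixes m :: int
  assumes m: "3 \<le> m"
    and residues: "\<And>x y. x\<^sup>2 + y\<^sup>2 = int n \<Longrightarrow> m dvd x - 1 \<or> m dvd x + 1"
  shows "r2 n = 4 * card {(p, q). (m * p - 1)\<^sup>2 + (m * q - 1)\<^sup>2 = int n}"
    and "finite {(p, q). (m * p - 1)\<^sup>2 + (m * q - 1)\<^sup>2 = int n}"
proof -
  let ?T = "{(p, q). (m * p - 1)\<^sup>2 + (m * q - 1)\<^sup>2 = int n}"
  let ?f = "\<lambda>((s, t), (p, q)). (s * (m * p - 1), t * (m * q - 1))"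
  have sign: "\<exists>s\<in>{1, -1}. \<exists>p. x = s * (m * p - 1)" if "m dvd x - 1 \<or> m dvd x + 1" for x
    using that
  proof
    assume "m dvd x - 1"
    then obtain k where "x - 1 = m * k" by (elim dvdE)
    then have "x = (- 1) * (m * (- k) - 1)" by simp
    then show ?thesis by blast
  next
    assume "m dvd x + 1"
    then obtain k where "x + 1 = m * k" by (elim dvdE)
    then have "x = 1 * (m * k - 1)" by simp
    then show ?thesis by blast
  qed
  have "inj_on ?f (({1, -1} \<times> {1, -1}) \<times> ?T)"
  proof (rule inj_onI)
    fix u v assume uv: "u \<in> ({1, -1} \<times> {1, -1}) \<times> ?T" "v \<in> ({1, -1} \<times> {1, -1}) \<times> ?T" "?f u = ?f v"
    obtain s t p q s' t' p' q' where "u = ((s, t), p, q)" "v = ((s', t'), p', q')"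
      by (metis surj_pair)
    then show "u = v"
      using uv sign_times_residue_eq[OF m, of s s' p p'] sign_times_residue_eq[OF m, of t t' q q'] by simp blast
  qed
  moreover have "?f ` (({1, -1} \<times> {1, -1}) \<times> ?T) = {(x, y). x\<^sup>2 + y\<^sup>2 = int n}"
  proof (intro equalityI subsetI)
    fix w assume "w \<in> {(x :: int, y :: int). x\<^sup>2 + y\<^sup>2 = int n}"
    then obtain x y where w: "w = (x, y)" and n: "x\<^sup>2 + y\<^sup>2 = int n" by auto
    obtain s p where s: "s \<in> {1, -1}" and x: "x = s * (m * p - 1)"
      using sign[OF residues[OF n]] by blast
    \<comment> \<open>\<open>residues\<close> speaks of the first coordinate only; exchanging the
      squares gives it for \<open>y\<close>.\<close>
    have "y\<^sup>2 + x\<^sup>2 = int n" using n by simp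
    then obtain t q where t: "t \<in> {1, -1}" and y: "y = t * (m * q - 1)"
      using sign[OF residues] by blast
    note st = s t
    have "(m * p - 1)\<^sup>2 + (m * q - 1)\<^sup>2 = int n"
      using n st unfolding x y power_mult_distrib by auto
    then show "w \<in> ?f ` (({1, -1} \<times> {1, -1}) \<times> ?T)"
      using st unfolding w x y by (intro image_eqI[of _ _ "((s, t), (p, q))"]) auto
  qed (auto simp: power2_commute[of 1])
  ultimately have bij: "bij_betw ?f (({1, -1} \<times> {1, -1}) \<times> ?T) {(x, y). x\<^sup>2 + y\<^sup>2 = int n}"
    by (simp add: bij_betw_def)
  then have "card (({1, -1 :: int} \<times> {1, -1 :: int}) \<times> ?T) = r2 n"
    unfolding r2_def by (rule bij_betw_same_card)
  then show "r2 n = 4 * card ?T" by (simp add: card_cartesian_product)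
  have "finite (({1, -1 :: int} \<times> {1, -1 :: int}) \<times> ?T)"
    using bij_betw_finite[OF bij] finite_sum_two_squares by blast
  then show "finite ?T" by (auto dest: finite_cartesian_productD2)
qed

lemma square_mod_3:
  fixes x :: int
  obtains a where "3 dvd x" "x\<^sup>2 = 3 * a" | a where "\<not> 3 dvd x" "x\<^sup>2 = 3 * a + 1"
proof -
  have "x = 3 * (x div 3) \<or> x = 3 * (x div 3) + 1 \<or> x = 3 * (x div 3) + 2" by presburger
  then obtain k where "x = 3 * k \<or> x = 3 * k + 1 \<or> x = 3 * k + 2" by blast
  then show ?thesis
  proof (elim disjE)
    assume x: "x = 3 * k"
    show ?thesis by (rule that(1)[of "3 * k * k"]) (simp_all add: x power2_eq_square)
  next
    assume x: "x = 3 * k + 1"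
    then have "\<not> 3 dvd x" by presburger
    then show ?thesis
      by (rule that(2)[of "3 * k * k + 2 * k"]) (simp add: x power2_eq_square algebra_simps)
  next
    assume x: "x = 3 * k + 2"
    then have "\<not> 3 dvd x" by presburger
    then show ?thesis
      by (rule that(2)[of "3 * k * k + 4 * k + 1"]) (simp add: x power2_eq_square algebra_simps)
  qed
qed

text \<open>The values are 2 modulo 4 for \<open>C21\<close> and 2 modulo 3 for \<open>D22\<close>,
  which excludes even squares in the first case and multiples of 3 in the second.\<close>

lemma norm_value_residues:
  assumes "x\<^sup>2 + y\<^sup>2 = norm_value X j (int N)"
  shows "modulus X dvd x - 1 \<or> modulus X dvd x + 1"
proof (cases X)
  case C21
  have "odd x"
    by (rule square_mod_4[of x]; rule square_mod_4[of y];
        use assms in \<open>simp add: C21 split: if_splits; presburger\<close>)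
  then show ?thesis unfolding C21 modulus.simps by presburger
next
  case D22
  have "\<not> 3 dvd x"
    by (rule square_mod_3[of x]; rule square_mod_3[of y];
        use assms in \<open>simp add: D22 split: if_splits; presburger\<close>)
  then show ?thesis unfolding D22 modulus.simps by presburger
qed

text \<open>For \<open>C21\<close> the equation is divided by 8; for \<open>D22\<close> it is
  reduced modulo 2, where \<open>3 * p - 1\<close> is \<open>p + 1\<close>. So the solutions lie all
  in \<open>alcove_orbit 1\<close> or are split between the other two classes.\<close>

lemma norm_value_parity:
  assumes "(modulus X * p - 1)\<^sup>2 + (modulus X * q - 1)\<^sup>2 = norm_value X j (int N)"
  shows "even (p + q) \<longleftrightarrow> j = 1"
proof (cases X)
  case C21
  have "p + q + (if j = 1 then 0 else 1) = 2 * (p * p + q * q - int N)"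
    using assms by (auto simp: C21 power2_eq_square algebra_simps split: if_splits)
  then show ?thesis by (auto split: if_splits) presburger+
next
  case D22
  show ?thesis
    using arg_cong[OF assms, of even] by (auto simp: D22 split: if_splits)
qed

section \<open>Counting cores by sums of two squares\<close>

context affine_realization
begin

lemma r2_eq_card_cores:
  assumes "j \<le> 2"
  shows "finite (cores j N)"
    and "r2 (nat (norm_value X j (int N))) = (if j = 1 then 4 else 8) * card (cores j N)"
proof -
  define T where "T = {(p, q). (modulus X * p - 1)\<^sup>2 + (modulus X * q - 1)\<^sup>2 = norm_value X j (int N)}"
  have norm: "int (nat (norm_value X j (int N))) = norm_value X j (int N)"
    by (cases X) auto
  have "3 \<le> modulus X" by (cases X) auto
  then have T: "r2 (nat (norm_value X j (int N))) = 4 * card T" "finite T"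
    using r2_eq_card_residues[of "modulus X" "nat (norm_value X j (int N))"] norm_value_residues[of _ _ X j N]
    unfolding norm T_def by blast+
  \<comment> \<open>The index \<open>i\<close> is kept apart from \<open>j\<close> because the case
    \<open>j \<noteq> 1\<close> compares the classes of 0 and 2 inside the same
    \<open>T\<close>.\<close>
  have B: "{(p, q) \<in> alcove_orbit i. (modulus X * p - 1)\<^sup>2 + (modulus X * q - 1)\<^sup>2 = norm_value X j (int N)}
    = alcove_orbit i \<inter> T" for i
    by (auto simp: T_def)
  note bij = bij_betw_alcove_coords[OF assms, of X N, unfolded B] bij_betw_cores[OF assms, of N]
  show "finite (cores j N)"
    using T(2) bij_betw_finite[OF bij(1)] bij_betw_finite[OF bij(2)] by blast
  have card: "card (cores j N) = card (alcove_orbit j \<inter> T)"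
    using bij_betw_same_card[OF bij(1)] bij_betw_same_card[OF bij(2)] by simp
  show "r2 (nat (norm_value X j (int N))) = (if j = 1 then 4 else 8) * card (cores j N)"
  proof (cases "j = 1")
    case True
    then have "alcove_orbit j \<inter> T = T"
      using norm_value_parity[of X _ _ j N] by (auto simp: T_def alcove_orbit_def)
    then show ?thesis using T(1) card True by simp
  next
    case False
    have "T = (alcove_orbit 0 \<inter> T) \<union> (alcove_orbit 2 \<inter> T)"
      using norm_value_parity[of X _ _ j N] False by (auto simp: T_def alcove_orbit_def)
    moreover have "alcove_orbit 0 \<inter> alcove_orbit 2 = {}" by (auto simp: alcove_orbit_def)
    ultimately have "card T = card (alcove_orbit 0 \<inter> T) + card (alcove_orbit 2 \<inter> T)"
      using T(2) by (metis card_Un_disjoint finite_Un inf_assoc inf_bot_left inf_commute)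
    \<comment> \<open>Exchanging \<open>p\<close> and \<open>q\<close> swaps the two classes and
      preserves the quadratic form; this is the extra factor 2 when \<open>j\<close> is not
      1.\<close>
    moreover have "card (alcove_orbit 0 \<inter> T) = card (alcove_orbit 2 \<inter> T)"
      by (rule bij_betw_same_card[of prod.swap], rule bij_betw_byWitness[of _ prod.swap])
        (auto simp: T_def alcove_orbit_def add.commute)
    moreover have "j = 0 \<or> j = 2" using assms False by auto
    ultimately have "card T = 2 * card (alcove_orbit j \<inter> T)" by auto
    then show ?thesis using T(1) card False by simp
  qed
qed

end

theorem theorem5p15:
  fixes scale :: "'k::field_char_0 \<Rightarrow> 'v::ab_group_add \<Rightarrow> 'v"
    and X :: affine_type
    and \<alpha> :: "nat \<Rightarrow> 'v"
    and coroot :: "nat \<Rightarrow> 'v \<Rightarrow> 'k"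
    and \<Lambda> :: "nat \<Rightarrow> 'v"
    and j N :: nat
  assumes "affine_realization scale X \<alpha> coroot \<Lambda>"
  defines "C \<equiv> affine_realization.cores scale \<alpha> coroot \<Lambda> j N"
  shows
    "(j \<in> {0, 1, 2} \<longrightarrow> finite C) \<and>
     (j \<in> {0, 2} \<and> X = C21 \<longrightarrow>
        real (card C) = 1/8 * real (r2 (16 * N + 10)) \<and>
        1/8 * real (r2 (16 * N + 10)) = 1/2 * (\<Sum>d | d dvd 16 * N + 10. real_of_int (chi4 d))) \<and>
     (j \<in> {0, 2} \<and> X = D22 \<longrightarrow>
        real (card C) = 1/8 * real (r2 (12 * N + 5)) \<and>
        1/8 * real (r2 (12 * N + 5)) = 1/2 * (\<Sum>d | d dvd 12 * N + 5. real_of_int (chi4 d))) \<and>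
     (j = 1 \<and> X = C21 \<longrightarrow>
        real (card C) = 1/4 * real (r2 (16 * N + 2)) \<and>
        1/4 * real (r2 (16 * N + 2)) = (\<Sum>d | d dvd 16 * N + 2. real_of_int (chi4 d))) \<and>
     (j = 1 \<and> X = D22 \<longrightarrow>
        real (card C) = 1/4 * real (r2 (6 * N + 2)) \<and>
        1/4 * real (r2 (6 * N + 2)) = (\<Sum>d | d dvd 6 * N + 2. real_of_int (chi4 d)))"
proof -
  interpret affine_realization scale X \<alpha> coroot \<Lambda> by (rule assms(1))
  have nat: "nat (16 * int N + 10) = 16 * N + 10" "nat (12 * int N + 5) = 12 * N + 5"
    "nat (16 * int N + 2) = 16 * N + 2" "nat (6 * int N + 2) = 6 * N + 2"
    by linarith+
  have jacobi: "1/8 * real (r2 n) = 1/2 * (\<Sum>d | d dvd n. real_of_int (chi4 d))"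
    "1/4 * real (r2 n) = (\<Sum>d | d dvd n. real_of_int (chi4 d))" if "0 < n" for n
    using jacobi_two_squares[OF that] by simp_all
  have pos: "0 < 16 * N + 10" "0 < 12 * N + 5" "0 < 16 * N + 2" "0 < 6 * N + 2" by simp_all
  have "finite C" if "j \<in> {0, 1, 2}"
    unfolding C_def using r2_eq_card_cores(1) that by auto
  moreover have "real (card C) = 1/8 * real (r2 (16 * N + 10))" if "j \<in> {0, 2}" "X = C21"
    using r2_eq_card_cores(2)[of j N] that unfolding C_def by (auto simp: nat)
  moreover have "real (card C) = 1/8 * real (r2 (12 * N + 5))" if "j \<in> {0, 2}" "X = D22"
    using r2_eq_card_cores(2)[of j N] that unfolding C_def by (auto simp: nat)
  moreover have "real (card C) = 1/4 * real (r2 (16 * N + 2))" if "j = 1" "X = C21"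
    using r2_eq_card_cores(2)[of j N] that unfolding C_def by (auto simp: nat)
  moreover have "real (card C) = 1/4 * real (r2 (6 * N + 2))" if "j = 1" "X = D22"
    using r2_eq_card_cores(2)[of j N] that unfolding C_def by (auto simp: nat)
  moreover note jacobi(1)[OF pos(1)] jacobi(1)[OF pos(2)] jacobi(2)[OF pos(3)] jacobi(2)[OF pos(4)]
  ultimately show ?thesis by blast
qed

end
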